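(* Let $n=2p$ and let $\underline{a}=[a_0,\dots,a_{n-1}]$ be a vector of complex random variables such that the $2n$-variate real vector $\tilde{\underline a}=\{\Re[\underline a],\Im[\underline a]\}$ is spherically distributed (centered at $\underline 0$, with $\Sigma=I_{2n}$) with density $$G(x)=\frac{\Gamma(n)}{2\pi^{n}}\,\|x\|^{1-2n}\,g(\|x\|),\qquad x\in\mathbb{R}^{2n},$$ where $g$ is the density of $\|\tilde{\underline a}\|$. Let $[p-1,p](z)$ be the random Padé approximant of order $(p-1,p)$ of the $Z$-transform of $\{a_k\}$, with poles $\xi_j$ $(j=1,\dots,p)$, zeros $\zeta_j$ $(j=1,\dots,p-1)$, residuals at the poles $\underline c$ and residuals at the zeros $\underline d$. Then: 1. the marginal density of the poles and of the zeros of $[p-1,p](z)$ is independent of $g$ and equal to the distribution obtained when $G$ is a standard Gaussian density; 2. all statistics of the normalized residuals at the poles $\frac{\underline c}{\|\underline c\|}$ and at the zeros $\frac{\underline d}{\|\underline d\|}$ have a distribution that is independent of $g$ and equal to the distribution obtained when $G$ is a standard Gaussian density.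
   Context: The $Z$-transform of $\{a_k\}$ is the formal random power series $F(z)=\sum_{k\ge 0}a_kz^{-k}$; its Padé approximant $[p-1,p](z)$ depends only on $a_0,\dots,a_{2p-1}$. The following quantities are defined almost surely. Poles: $\xi_1,\dots,\xi_p$ are the generalized eigenvalues of the pencil $[U_1,U_0]$, i.e. the solutions $\xi$ of $\det(U_1-\xi U_0)=0$, where $U_0,U_1$ are the $p\times p$ Hankel matrices $U_0=(a_{i+j})_{i,j=0}^{p-1}$, $U_1=(a_{i+j+1})_{i,j=0}^{p-1}$. Zeros: let $T(\underline a)$ be the lower triangular Toeplitz matrix with first column $\underline a=[a_0,\dots,a_{n-1}]^T$ and put $\underline b=[b_0,\dots,b_{n-1}]^T=T(\underline a)^{-1}\underline e_1$, $\underline e_1=[1,0,\dots,0]^T$ (so that $1/F(z)=\sum_k b_kz^{-k}$). The zeros $\zeta_1,\dots,\zeta_{p-1}$ are the generalized eigenvalues of the pencil $[\tilde U_1,\tilde U_0]$, i.e. the solutions of $\det(\tilde U_1-\zeta\tilde U_0)=0$, where $\tilde U_0=(b_{i+j+2})_{i,j=0}^{p-2}$, $\tilde U_1=(b_{i+j+3})_{i,j=0}^{p-2}$ are $(p-1)\times(p-1)$ Hankel matrices. Residuals: $\underline c=V(\underline\xi)^{-1}[a_0,\dots,a_{p-1}]^T$, so that $a_k=\sum_{j=1}^pc_j\xi_j^k$; and $\underline d=V(\underline\zeta)^{-1}[b_2,\dots,b_{p}]^T$. Here $V(\underline\xi)$ is the square Vandermonde matrix with entries $\xi_j^{k}$ (row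 index $k=0,1,\dots$, column index $j$), and similarly for $V(\underline\zeta)$. $\|\cdot\|$ is the Euclidean norm. The poles and the zeros carry no preferred ordering; all statements on them are understood independently of the labelling. *)

theory Defs
  imports "HOL-Probability.Probability" "Jordan_Normal_Form.Determinant"
    "Jordan_Normal_Form.Gauss_Jordan_Elimination"
begin

hide_const (open) Finite_Cartesian_Product.vec Finite_Cartesian_Product.mat Determinants.det
no_notation Finite_Cartesian_Product.vec_nth (infixl "$" 90)

text \<open>
  Vectors are functions on the naturals that are only inspected on an initial segment
  \<open>{..<m}\<close>; as random elements they live in the corresponding finite product space.
\<close>

abbreviation cvec_space :: "nat \<Rightarrow> (nat \<Rightarrow> complex) measure" where
  "cvec_space m \<equiv> \<Pi>\<^sub>M i\<in>{..<m}. borel"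

abbreviation rvec_space :: "nat \<Rightarrow> (nat \<Rightarrow> real) measure" where
  "rvec_space m \<equiv> \<Pi>\<^sub>M i\<in>{..<m}. lborel"

definition re_im_vector :: "nat \<Rightarrow> (nat \<Rightarrow> complex) \<Rightarrow> nat \<Rightarrow> real" where
  "re_im_vector n a = (\<lambda>i\<in>{..<2 * n}. if i < n then Re (a i) else Im (a (i - n)))"

text \<open>
  The radial density on \<open>2n\<close>-dimensional space whose norm has density \<open>g\<close>: the constant is the
  inverse surface area of the unit sphere.
\<close>

definition spherical_density :: "nat \<Rightarrow> (real \<Rightarrow> real) \<Rightarrow> (nat \<Rightarrow> real) \<Rightarrow> real" where
  "spherical_density n g x =
     Gamma (real n) / (2 * pi ^ n) * L2_set x {..<2 * n} powi (1 - 2 * int n)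
       * g (L2_set x {..<2 * n})"

definition standard_gaussian_density :: "nat \<Rightarrow> (nat \<Rightarrow> real) \<Rightarrow> real" where
  "standard_gaussian_density m x = (\<Prod>i<m. std_normal_density (x i))"

text \<open>
  Totalised inverse. Singular matrices, for which the value is set to zero, only
  arise below on an event of probability zero.
\<close>

definition inv_mat :: "complex mat \<Rightarrow> complex mat" where
  "inv_mat A = (case mat_inverse A of Some B \<Rightarrow> B | None \<Rightarrow> 0\<^sub>m (dim_row A) (dim_row A))"

definition generalized_eigenvalues :: "complex mat \<Rightarrow> complex mat \<Rightarrow> complex set" where
  "generalized_eigenvalues A B = {z. det (A - z \<cdot>\<^sub>m B) = 0}"

text \<open>The \<open>m \<times> m\<close> Hankel matrix starting at the entry \<open>s\<^sub>r\<close>.\<close>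

definition hankel :: "nat \<Rightarrow> nat \<Rightarrow> (nat \<Rightarrow> complex) \<Rightarrow> complex mat" where
  "hankel m r s = mat m m (\<lambda>(i, j). s (i + j + r))"

definition lower_toeplitz :: "nat \<Rightarrow> (nat \<Rightarrow> complex) \<Rightarrow> complex mat" where
  "lower_toeplitz n a = mat n n (\<lambda>(i, j). if j \<le> i then a (i - j) else 0)"

definition vandermonde :: "nat \<Rightarrow> (nat \<Rightarrow> complex) \<Rightarrow> complex mat" where
  "vandermonde m x = mat m m (\<lambda>(k, j). x j ^ k)"

definition reciprocal_coeffs :: "nat \<Rightarrow> (nat \<Rightarrow> complex) \<Rightarrow> nat \<Rightarrow> complex" where
  "reciprocal_coeffs n a k = (inv_mat (lower_toeplitz n a) *\<^sub>v unit_vec n 0) $ k"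

definition pade_poles :: "nat \<Rightarrow> (nat \<Rightarrow> complex) \<Rightarrow> complex set" where
  "pade_poles p a = generalized_eigenvalues (hankel p 1 a) (hankel p 0 a)"

definition pade_zeros :: "nat \<Rightarrow> (nat \<Rightarrow> complex) \<Rightarrow> complex set" where
  "pade_zeros p a =
     (let b = reciprocal_coeffs (2 * p) a
      in generalized_eigenvalues (hankel (p - 1) 3 b) (hankel (p - 1) 2 b))"

text \<open>
  A labelling rule \<open>\<Lambda>\<close> enumerates every \<open>m\<close>-element set of complex numbers. Almost surely the poles
  (zeros) form a set of \<open>p\<close> (\<open>p - 1\<close>) distinct points, so the values of \<open>\<Lambda>\<close> on sets of other
  cardinalities are immaterial. The order chosen by \<open>\<Lambda>\<close> depends on the unordered set only; a rule
  that inspects the data further, for instance their norm, could make the order itself depend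
  on the radial law. The measurability conditions further down say that the labelled poles (zeros)
  are Borel functions of the data, as is the case for instance for the lexicographic order.
\<close>

definition labelling :: "nat \<Rightarrow> (complex set \<Rightarrow> nat \<Rightarrow> complex) \<Rightarrow> bool" where
  "labelling m \<Lambda> \<longleftrightarrow> (\<forall>S. finite S \<and> card S = m \<longrightarrow> bij_betw (\<Lambda> S) {..<m} S)"

definition pole_labelling :: "nat \<Rightarrow> (complex set \<Rightarrow> nat \<Rightarrow> complex) \<Rightarrow> bool" where
  "pole_labelling p \<Lambda> \<longleftrightarrow> labelling p \<Lambda> \<and>
     (\<forall>j<p. (\<lambda>a. \<Lambda> (pade_poles p a) j) \<in> borel_measurable (cvec_space (2 * p)))"

definition zero_labelling :: "nat \<Rightarrow> (complex set \<Rightarrow> nat \<Rightarrow> complex) \<Rightarrow> bool" where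
  "zero_labelling p \<Lambda> \<longleftrightarrow> labelling (p - 1) \<Lambda> \<and>
     (\<forall>j<p - 1. (\<lambda>a. \<Lambda> (pade_zeros p a) j) \<in> borel_measurable (cvec_space (2 * p)))"

definition pole_vector ::
    "nat \<Rightarrow> (complex set \<Rightarrow> nat \<Rightarrow> complex) \<Rightarrow> (nat \<Rightarrow> complex) \<Rightarrow> nat \<Rightarrow> complex" where
  "pole_vector p \<Lambda> a = restrict (\<Lambda> (pade_poles p a)) {..<p}"

definition zero_vector ::
    "nat \<Rightarrow> (complex set \<Rightarrow> nat \<Rightarrow> complex) \<Rightarrow> (nat \<Rightarrow> complex) \<Rightarrow> nat \<Rightarrow> complex" where
  "zero_vector p \<Lambda> a = restrict (\<Lambda> (pade_zeros p a)) {..<p - 1}"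

definition pole_residuals ::
    "nat \<Rightarrow> (complex set \<Rightarrow> nat \<Rightarrow> complex) \<Rightarrow> (nat \<Rightarrow> complex) \<Rightarrow> complex vec" where
  "pole_residuals p \<Lambda> a = inv_mat (vandermonde p (pole_vector p \<Lambda> a)) *\<^sub>v vec p a"

definition zero_residuals ::
    "nat \<Rightarrow> (complex set \<Rightarrow> nat \<Rightarrow> complex) \<Rightarrow> (nat \<Rightarrow> complex) \<Rightarrow> complex vec" where
  "zero_residuals p \<Lambda> a =
     inv_mat (vandermonde (p - 1) (zero_vector p \<Lambda> a))
       *\<^sub>v vec (p - 1) (\<lambda>k. reciprocal_coeffs (2 * p) a (k + 2))"

definition normalized :: "complex vec \<Rightarrow> nat \<Rightarrow> complex" where
  "normalized v =
     (\<lambda>j\<in>{..<dim_vec v}. v $ j / complex_of_real (L2_set (\<lambda>i. cmod (v $ i)) {..<dim_vec v}))"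

definition equal_in_law ::
    "'c measure \<Rightarrow> 'a measure \<Rightarrow> ('a \<Rightarrow> 'c) \<Rightarrow> 'b measure \<Rightarrow> ('b \<Rightarrow> 'c) \<Rightarrow> bool" where
  "equal_in_law N M X M' X' \<longleftrightarrow>
     X \<in> measurable M N \<and> X' \<in> measurable M' N \<and> distr M N X = distr M' N X'"

end

theory Submission imports Defs begin

text \<open>
  The poles, the zeros and the normalized residuals are unchanged when the data are multiplied by a
  positive scalar: the Hankel pencils and the residuals are only multiplied by a positive scalar. Hence
  the event that a statistic lies in a given set is a cone \<open>B\<close>. By scaling of Lebesgue measure, the volume of
  \<open>{x \<in> B. \<parallel>x\<parallel> \<le> t}\<close> is \<open>t\<close> to the power of the dimension times its value at \<open>t = 1\<close>, so the
  push-forward of Lebesgue measure on \<open>B\<close> under the norm depends on \<open>B\<close> only through a constant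
  factor. A cone therefore has the same probability under every radial density, namely the fraction
  of the unit ball that it occupies.
\<close>

section \<open>Radial densities and cones\<close>

text \<open>A product measure is determined by its values on boxes. On a box each coordinate
  contributes one factor \<open>r\<close>, because the push-forward of \<open>lborel\<close> under
  multiplication by \<open>r\<close> has constant density \<open>inverse r\<close>; the factors
  multiply to \<open>r ^ card I\<close>. The restriction to \<open>I\<close> keeps the dilated point
  in the extensional space.\<close>

lemma emeasure_PiM_lborel_dilation:
  fixes r :: real and I :: "'i set"
  assumes I: "finite I" and r: "r > 0" and A: "A \<in> sets (\<Pi>\<^sub>M i\<in>I. lborel)"
  shows "ennreal (r ^ card I) *
      emeasure (\<Pi>\<^sub>M i\<in>I. lborel) {x \<in> space (\<Pi>\<^sub>M i\<in>I. lborel). (\<lambda>i\<in>I. r * x i) \<in> A}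
    = emeasure (\<Pi>\<^sub>M i\<in>I. lborel) A"
proof -
  let ?L = "\<Pi>\<^sub>M i\<in>I. (lborel :: real measure)"
  let ?h = "\<lambda>x. \<lambda>i\<in>I. r * x i"
  let ?P = "scale_measure (ennreal (r ^ card I)) (distr ?L ?L ?h)"
  interpret product_sigma_finite "\<lambda>_::'i. lborel :: real measure" ..
  have h: "?h \<in> measurable ?L ?L" by measurable
  have "?P = ?L"
  proof (rule PiM_eqI[OF I])
    show "sets ?P = sets ?L" by simp
  next
    fix S :: "'i \<Rightarrow> real set"
    assume S: "\<And>i. i \<in> I \<Longrightarrow> S i \<in> sets lborel"
    have pre: "?h -` Pi\<^sub>E I S \<inter> space ?L = Pi\<^sub>E I (\<lambda>i. (*) r -` S i)"
      by (auto simp: space_PiM PiE_iff)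
    have one: "ennreal r * emeasure lborel ((*) r -` S i) = emeasure lborel (S i)" if "i \<in> I" for i
    proof -
      have Si: "S i \<in> sets borel" using S[OF that] by simp
      have "emeasure lborel ((*) r -` S i) = emeasure (distr lborel borel ((*) r)) (S i)"
        using Si by (subst emeasure_distr) auto
      also have "\<dots> = ennreal (inverse r) * emeasure lborel (S i)"
        using Si r by (subst lborel_distr_mult) (auto simp: emeasure_density nn_integral_cmult)
      finally show ?thesis
        using r by (simp add: mult.assoc[symmetric] ennreal_mult'[symmetric])
    qed
    have S': "(*) r -` S i \<in> sets lborel" if "i \<in> I" for i
    proof -
      have "(*) r -` S i \<inter> space borel \<in> sets borel"
        using S[OF that] by (intro measurable_sets[where A = borel]) auto
      then show ?thesis by simp
    qed
    have "emeasure ?P (Pi\<^sub>E I S) = ennreal (r ^ card I) * emeasure ?L (Pi\<^sub>E I (\<lambda>i. (*) r -` S i))"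
      using I S by (simp add: emeasure_distr[OF h] pre sets_PiM_I_finite)
    also have "\<dots> = (\<Prod>i\<in>I. ennreal r) * (\<Prod>i\<in>I. emeasure lborel ((*) r -` S i))"
      using I S' r by (simp add: emeasure_PiM ennreal_power)
    also have "\<dots> = (\<Prod>i\<in>I. emeasure lborel (S i))"
      unfolding prod.distrib[symmetric] by (intro prod.cong refl one)
    finally show "emeasure ?P (Pi\<^sub>E I S) = (\<Prod>i\<in>I. emeasure lborel (S i))" .
  qed
  then have "emeasure ?L A = emeasure ?P A" by simp
  also have "\<dots> = ennreal (r ^ card I) * emeasure ?L (?h -` A \<inter> space ?L)"
    using A by (simp add: emeasure_distr[OF h])
  also have "?h -` A \<inter> space ?L = {x \<in> space ?L. ?h x \<in> A}" by auto
  finally show ?thesis by simp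
qed

lemma measurable_L2_set_PiM [measurable]:
  "(\<lambda>x. L2_set x I) \<in> borel_measurable (\<Pi>\<^sub>M i\<in>I. (lborel :: real measure))"
  unfolding L2_set_def by measurable

text \<open>The volume of the unit ball later has to be cancelled in an equation over
  \<open>ennreal\<close>, which requires both bounds. The ball contains a small cube, since the
  Euclidean norm is at most the sum of the absolute values, and it lies in the cube with sides
  \<open>{-1..1}\<close>.\<close>

lemma emeasure_unit_ball_PiM:
  assumes I: "finite I" "I \<noteq> {}"
  shows "emeasure (\<Pi>\<^sub>M i\<in>I. lborel) {x \<in> space (\<Pi>\<^sub>M i\<in>I. lborel). L2_set x I \<le> 1} \<noteq> 0"
    and "emeasure (\<Pi>\<^sub>M i\<in>I. lborel) {x \<in> space (\<Pi>\<^sub>M i\<in>I. lborel). L2_set x I \<le> 1} \<noteq> \<infinity>"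
proof -
  let ?L = "\<Pi>\<^sub>M i\<in>I. (lborel :: real measure)"
  let ?U = "{x \<in> space ?L. L2_set x I \<le> 1}"
  interpret product_sigma_finite "\<lambda>_::'a. lborel :: real measure" ..
  \<comment> \<open>With this side length the coordinates of a point of the cube sum to at most
    1.\<close>
  define d where "d = 1 / real (card I)"
  have d: "d > 0" unfolding d_def using I by (simp add: card_gt_0_iff)
  have U: "?U \<in> sets ?L" by measurable
  have "Pi\<^sub>E I (\<lambda>_. {0..d}) \<subseteq> ?U"
  proof safe
    fix x assume x: "x \<in> Pi\<^sub>E I (\<lambda>_. {0..d})"
    then show "x \<in> space ?L" by (auto simp: space_PiM PiE_iff)
    have "L2_set x I \<le> (\<Sum>i\<in>I. \<bar>x i\<bar>)" by (rule L2_set_le_sum_abs)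
    also have "\<dots> \<le> (\<Sum>i\<in>I. d)" using x by (intro sum_mono) (auto simp: PiE_iff)
    also have "\<dots> = 1" using I by (simp add: d_def)
    finally show "L2_set x I \<le> 1" .
  qed
  then have "emeasure ?L (Pi\<^sub>E I (\<lambda>_. {0..d})) \<le> emeasure ?L ?U"
    using U by (rule emeasure_mono)
  moreover have "emeasure ?L (Pi\<^sub>E I (\<lambda>_. {0..d})) = ennreal d ^ card I"
    using I d by (simp add: emeasure_PiM)
  ultimately show "emeasure ?L ?U \<noteq> 0"
    using d by (auto simp: ennreal_power)
  have "?U \<subseteq> Pi\<^sub>E I (\<lambda>_. {-1..1})"
  proof
    fix x assume x: "x \<in> ?U"
    have "\<bar>x i\<bar> \<le> 1" if "i \<in> I" for i
    proof -
      have "(x i)\<^sup>2 \<le> (\<Sum>i\<in>I. (x i)\<^sup>2)"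
        using I that by (intro member_le_sum) auto
      then have "\<bar>x i\<bar> \<le> L2_set x I"
        unfolding L2_set_def by (metis real_sqrt_abs real_sqrt_le_iff)
      with x show ?thesis by simp
    qed
    then show "x \<in> Pi\<^sub>E I (\<lambda>_. {-1..1})"
      using x by (auto simp: space_PiM PiE_iff abs_le_iff)
  qed
  then have "emeasure ?L ?U \<le> emeasure ?L (Pi\<^sub>E I (\<lambda>_. {-1..1}))"
    using I by (intro emeasure_mono sets_PiM_I_finite) auto
  also have "\<dots> < \<infinity>"
    using I by (simp add: emeasure_PiM ennreal_prod_eq_top less_top[symmetric] power_eq_top_ennreal)
  finally show "emeasure ?L ?U \<noteq> \<infinity>" by simp
qed

text \<open>For \<open>t > 0\<close>, dilation by \<open>t\<close> carries the part of the cone in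
  the unit ball onto its part in the ball of radius \<open>t\<close>. The formula covers every real
  \<open>t\<close> because it will serve as a distribution function on the whole line.\<close>

lemma emeasure_cone_ball:
  fixes B :: "('i \<Rightarrow> real) set"
  assumes I: "finite I" "I \<noteq> {}" and B: "B \<in> sets (\<Pi>\<^sub>M i\<in>I. lborel)"
    and cone: "\<And>x r. x \<in> space (\<Pi>\<^sub>M i\<in>I. lborel) \<Longrightarrow> r > 0 \<Longrightarrow> (\<lambda>i\<in>I. r * x i) \<in> B \<longleftrightarrow> x \<in> B"
  shows "emeasure (\<Pi>\<^sub>M i\<in>I. lborel) {x \<in> B. L2_set x I \<le> t}
    = (if t > 0 then ennreal (t ^ card I) else 0)
        * emeasure (\<Pi>\<^sub>M i\<in>I. lborel) {x \<in> B. L2_set x I \<le> 1}"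
proof -
  let ?L = "\<Pi>\<^sub>M i\<in>I. (lborel :: real measure)"
  interpret product_sigma_finite "\<lambda>_::'i. lborel :: real measure" ..
  have Bsp: "B \<subseteq> space ?L" using B by (rule sets.sets_into_space)
  have meas: "{x \<in> B. L2_set x I \<le> s} \<in> sets ?L" for s
  proof -
    have "{x \<in> B. L2_set x I \<le> s} = B \<inter> {x \<in> space ?L. L2_set x I \<le> s}" using Bsp by auto
    also have "\<dots> \<in> sets ?L" using B by measurable
    finally show ?thesis .
  qed
  show ?thesis
  proof (cases "t > 0")
    case True
    have L2: "L2_set (\<lambda>i\<in>I. t * x i) I \<le> t \<longleftrightarrow> L2_set x I \<le> 1" for x
    proof -
      have "L2_set (\<lambda>i\<in>I. t * x i) I = L2_set (\<lambda>i. t * x i) I" by (rule L2_set_cong) auto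
      also have "\<dots> = t * L2_set x I" using True by (simp add: L2_set_right_distrib)
      finally show ?thesis using True by (simp add: mult_le_cancel_left1)
    qed
    have "{x \<in> space ?L. (\<lambda>i\<in>I. t * x i) \<in> {x \<in> B. L2_set x I \<le> t}} = {x \<in> B. L2_set x I \<le> 1}"
      using cone[OF _ True] Bsp L2 by auto
    with emeasure_PiM_lborel_dilation[OF I(1) True meas[of t]] True show ?thesis by simp
  next
    case False
    \<comment> \<open>The set is empty for \<open>t < 0\<close> and at most the origin for
      \<open>t = 0\<close>; the origin is a null set because \<open>I\<close> is nonempty.\<close>
    have "{x \<in> B. L2_set x I \<le> t} \<subseteq> Pi\<^sub>E I (\<lambda>_. {0})"
    proof
      fix x assume "x \<in> {x \<in> B. L2_set x I \<le> t}"
      then have x: "x \<in> B" "L2_set x I \<le> 0" using False by auto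
      then have "L2_set x I = 0" by (simp add: antisym)
      then have "\<forall>i\<in>I. x i = 0" using I by (simp add: L2_set_eq_0_iff)
      moreover have "x \<in> extensional I" using x Bsp by (auto simp: space_PiM PiE_iff)
      ultimately show "x \<in> Pi\<^sub>E I (\<lambda>_. {0})" by (simp only: PiE_iff singleton_iff)
    qed
    then have "emeasure ?L {x \<in> B. L2_set x I \<le> t} \<le> emeasure ?L (Pi\<^sub>E I (\<lambda>_. {0}))"
      using I by (intro emeasure_mono sets_PiM_I_finite) auto
    also have "\<dots> = 0"
      using I by (subst emeasure_PiM) (simp_all add: card_gt_0_iff)
    finally show ?thesis using False by simp
  qed
qed

text \<open>Under the norm, Lebesgue measure on \<open>B\<close> and on the whole space are pushed
  to measures on the line whose distribution functions are multiples of the same function of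
  \<open>t\<close>. The multiples are the two unit-ball volumes. The claim is cross-multiplied so
  that no division in \<open>ennreal\<close> occurs.\<close>

lemma nn_integral_radial_cone:
  fixes B :: "('i \<Rightarrow> real) set"
  assumes I: "finite I" "I \<noteq> {}" and B: "B \<in> sets (\<Pi>\<^sub>M i\<in>I. lborel)"
    and cone: "\<And>x r. x \<in> space (\<Pi>\<^sub>M i\<in>I. lborel) \<Longrightarrow> r > 0 \<Longrightarrow> (\<lambda>i\<in>I. r * x i) \<in> B \<longleftrightarrow> x \<in> B"
    and f [measurable]: "f \<in> borel_measurable borel"
  shows "emeasure (\<Pi>\<^sub>M i\<in>I. lborel) {x \<in> space (\<Pi>\<^sub>M i\<in>I. lborel). L2_set x I \<le> 1}
        * (\<integral>\<^sup>+x. f (L2_set x I) * indicator B x \<partial>(\<Pi>\<^sub>M i\<in>I. lborel))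
    = emeasure (\<Pi>\<^sub>M i\<in>I. lborel) {x \<in> B. L2_set x I \<le> 1}
        * (\<integral>\<^sup>+x. f (L2_set x I) \<partial>(\<Pi>\<^sub>M i\<in>I. lborel))"
proof -
  let ?L = "\<Pi>\<^sub>M i\<in>I. (lborel :: real measure)"
  \<comment> \<open>\<open>K\<close> gives the constant belonging to a cone, and
    \<open>\<nu>\<close> the push-forward under the norm of Lebesgue measure on the cone. Both are
    used for \<open>B\<close> and for the whole space, which is itself a cone.\<close>
  define K where "K = (\<lambda>B. emeasure ?L {x \<in> B. L2_set x I \<le> 1})"
  define \<nu> where "\<nu> = (\<lambda>B. distr (density ?L (indicator B)) borel (\<lambda>x. L2_set x I))"
  let ?S = "space ?L"
  have Bsp: "B \<subseteq> ?S" using B by (rule sets.sets_into_space)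
  have S: "?S \<in> sets ?L" by simp
  have coneS: "(\<lambda>i\<in>I. r * x i) \<in> ?S \<longleftrightarrow> x \<in> ?S" if "x \<in> ?S" for x and r :: real
    using that by (simp add: space_PiM)
  have atMost: "emeasure (\<nu> C) {..t} = emeasure ?L {x \<in> C. L2_set x I \<le> t}"
    if C [measurable]: "C \<in> sets ?L" for C t
  proof -
    have "emeasure (\<nu> C) {..t}
        = emeasure (density ?L (indicator C)) {x \<in> ?S. L2_set x I \<le> t}"
      unfolding \<nu>_def by (subst emeasure_distr) (auto intro!: arg_cong[where f = "emeasure _"])
    also have "\<dots> = (\<integral>\<^sup>+x. indicator C x * indicator {x \<in> ?S. L2_set x I \<le> t} x \<partial>?L)"
      by (rule emeasure_density) measurable
    also have "\<dots> = (\<integral>\<^sup>+x. indicator (C \<inter> {x \<in> ?S. L2_set x I \<le> t}) x \<partial>?L)"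
      by (simp add: indicator_inter_arith)
    also have "\<dots> = emeasure ?L (C \<inter> {x \<in> ?S. L2_set x I \<le> t})"
      by (rule nn_integral_indicator) measurable
    also have "C \<inter> {x \<in> ?S. L2_set x I \<le> t} = {x \<in> C. L2_set x I \<le> t}"
      using sets.sets_into_space[OF C] by auto
    finally show ?thesis .
  qed
  have eqB: "emeasure (\<nu> B) {..t} = (if t > 0 then ennreal (t ^ card I) else 0) * K B" for t
    unfolding atMost[OF B] K_def by (rule emeasure_cone_ball[OF I B cone])
  have eqS: "emeasure (\<nu> ?S) {..t} = (if t > 0 then ennreal (t ^ card I) else 0) * K ?S" for t
    unfolding atMost[OF S] K_def by (rule emeasure_cone_ball[OF I S coneS])
  \<comment> \<open>Finiteness of both constants makes the half-lines \<open>{..real i}\<close> sets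
    of finite measure, as uniqueness on a generator demands.\<close>
  have KS: "K ?S \<noteq> \<infinity>"
    unfolding K_def by (rule emeasure_unit_ball_PiM(2)[OF I])
  have KB: "K B \<noteq> \<infinity>"
  proof -
    have "K B \<le> K ?S" unfolding K_def using Bsp by (intro emeasure_mono) auto
    with KS show ?thesis by (auto simp: top_unique)
  qed
  have "scale_measure (K ?S) (\<nu> B) = scale_measure (K B) (\<nu> ?S)"
  proof (rule measure_eqI_generator_eq[where E = "range atMost" and \<Omega> = UNIV
        and A = "\<lambda>i. {..real i}"])
    show "Int_stable (range (atMost :: real \<Rightarrow> _))"
      by (auto simp: Int_stable_def)
    show "sets (scale_measure (K ?S) (\<nu> B)) = sigma_sets UNIV (range atMost)"
      "sets (scale_measure (K B) (\<nu> ?S)) = sigma_sets UNIV (range atMost)"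
      by (simp_all add: \<nu>_def borel_eq_atMost)
    show "(\<Union>i. {..real i}) = UNIV"
      by (auto intro: real_arch_simple)
    show "emeasure (scale_measure (K ?S) (\<nu> B)) {..real i} \<noteq> \<infinity>" for i
      using KS KB by (simp add: eqB ennreal_mult_eq_top_iff)
  qed (auto simp: eqB eqS mult_ac)
  then have "(\<integral>\<^sup>+r. f r \<partial>scale_measure (K ?S) (\<nu> B)) = (\<integral>\<^sup>+r. f r \<partial>scale_measure (K B) (\<nu> ?S))"
    by simp
  moreover have "(\<integral>\<^sup>+r. f r \<partial>\<nu> C) = (\<integral>\<^sup>+x. f (L2_set x I) * indicator C x \<partial>?L)"
    if [measurable]: "C \<in> sets ?L" for C
    unfolding \<nu>_def by (simp add: nn_integral_distr nn_integral_density mult.commute)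
  moreover have "(\<integral>\<^sup>+x. f (L2_set x I) * indicator ?S x \<partial>?L) = (\<integral>\<^sup>+x. f (L2_set x I) \<partial>?L)"
    by (intro nn_integral_cong) simp
  ultimately show ?thesis
    using B by (simp add: nn_integral_scale_measure \<nu>_def K_def)
qed

section \<open>Laws of scale-invariant statistics of radial vectors\<close>

text \<open>Invariance of \<open>F\<close> under dilations makes the preimage of \<open>A\<close> a
  cone, and the density has total integral 1. What remains on the right-hand side involves neither
  \<open>f\<close> nor \<open>M\<close>.\<close>

lemma emeasure_radial_law:
  fixes f :: "real \<Rightarrow> ennreal" and X :: "'a \<Rightarrow> 'i \<Rightarrow> real"
  assumes I: "finite I" "I \<noteq> {}"
    and M: "prob_space M"
    and f: "f \<in> borel_measurable borel"
    and X: "distributed M (\<Pi>\<^sub>M i\<in>I. lborel) X (\<lambda>x. f (L2_set x I))"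
    and F: "F \<in> measurable (\<Pi>\<^sub>M i\<in>I. lborel) N"
    and hom: "\<And>x r. x \<in> space (\<Pi>\<^sub>M i\<in>I. lborel) \<Longrightarrow> r > 0 \<Longrightarrow> F (\<lambda>i\<in>I. r * x i) = F x"
    and A: "A \<in> sets N"
  shows "emeasure (\<Pi>\<^sub>M i\<in>I. lborel) {x \<in> space (\<Pi>\<^sub>M i\<in>I. lborel). L2_set x I \<le> 1}
        * emeasure (distr M N (\<lambda>\<omega>. F (X \<omega>))) A
    = emeasure (\<Pi>\<^sub>M i\<in>I. lborel) {x \<in> F -` A \<inter> space (\<Pi>\<^sub>M i\<in>I. lborel). L2_set x I \<le> 1}"
proof -
  let ?L = "\<Pi>\<^sub>M i\<in>I. (lborel :: real measure)"
  let ?B = "F -` A \<inter> space ?L"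
  interpret prob_space M by fact
  have mX: "X \<in> measurable M ?L" using X by (auto simp: distributed_def)
  have B: "?B \<in> sets ?L" using F A by (rule measurable_sets)
  have cone: "(\<lambda>i\<in>I. r * x i) \<in> ?B \<longleftrightarrow> x \<in> ?B" if "x \<in> space ?L" "r > 0" for x r
    using hom[OF that] that by (simp add: space_PiM)
  have "(\<lambda>\<omega>. F (X \<omega>)) -` A \<inter> space M = X -` ?B \<inter> space M"
    using measurable_space[OF mX] by auto
  then have law: "emeasure (distr M N (\<lambda>\<omega>. F (X \<omega>))) A
      = (\<integral>\<^sup>+x. f (L2_set x I) * indicator ?B x \<partial>?L)"
    using A measurable_compose[OF mX F] distributed_emeasure[OF X B]
    by (simp add: emeasure_distr)
  have "(\<integral>\<^sup>+x. f (L2_set x I) \<partial>?L)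
      = (\<integral>\<^sup>+x. f (L2_set x I) * indicator (space ?L) x \<partial>?L)"
    by (intro nn_integral_cong) simp
  also have "\<dots> = emeasure M (X -` space ?L \<inter> space M)"
    using distributed_emeasure[OF X sets.top] by simp
  also have "X -` space ?L \<inter> space M = space M"
    using measurable_space[OF mX] by auto
  also have "emeasure M (space M) = 1" by (rule emeasure_space_1)
  finally have total: "(\<integral>\<^sup>+x. f (L2_set x I) \<partial>?L) = 1" .
  show ?thesis
    using nn_integral_radial_cone[OF I B cone f] unfolding law total by simp
qed

text \<open>Both laws, multiplied by the volume of the unit ball, equal the same quantity; this
  volume is neither zero nor infinite and cancels.\<close>

lemma radial_density_unique_law:
  fixes f f' :: "real \<Rightarrow> ennreal" and X :: "'a \<Rightarrow> 'i \<Rightarrow> real" and X' :: "'b \<Rightarrow> 'i \<Rightarrow> real"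
  assumes I: "finite I" "I \<noteq> {}"
    and M: "prob_space M" and M': "prob_space M'"
    and f: "f \<in> borel_measurable borel" and f': "f' \<in> borel_measurable borel"
    and X: "distributed M (\<Pi>\<^sub>M i\<in>I. lborel) X (\<lambda>x. f (L2_set x I))"
    and X': "distributed M' (\<Pi>\<^sub>M i\<in>I. lborel) X' (\<lambda>x. f' (L2_set x I))"
    and F: "F \<in> measurable (\<Pi>\<^sub>M i\<in>I. lborel) N"
    and hom: "\<And>x r. x \<in> space (\<Pi>\<^sub>M i\<in>I. lborel) \<Longrightarrow> r > 0 \<Longrightarrow> F (\<lambda>i\<in>I. r * x i) = F x"
  shows "equal_in_law N M (\<lambda>\<omega>. F (X \<omega>)) M' (\<lambda>\<omega>. F (X' \<omega>))"
proof -
  let ?L = "\<Pi>\<^sub>M i\<in>I. (lborel :: real measure)"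
  have mX: "X \<in> measurable M ?L" and mX': "X' \<in> measurable M' ?L"
    using X X' by (auto simp: distributed_def)
  have "distr M N (\<lambda>\<omega>. F (X \<omega>)) = distr M' N (\<lambda>\<omega>. F (X' \<omega>))"
  proof (rule measure_eqI)
    fix A assume "A \<in> sets (distr M N (\<lambda>\<omega>. F (X \<omega>)))"
    then have A: "A \<in> sets N" by simp
    have "emeasure ?L {x \<in> space ?L. L2_set x I \<le> 1} * emeasure (distr M N (\<lambda>\<omega>. F (X \<omega>))) A
        = emeasure ?L {x \<in> space ?L. L2_set x I \<le> 1} * emeasure (distr M' N (\<lambda>\<omega>. F (X' \<omega>))) A"
      using emeasure_radial_law[OF I M f X F hom A] emeasure_radial_law[OF I M' f' X' F hom A]
      by simp
    then show "emeasure (distr M N (\<lambda>\<omega>. F (X \<omega>))) A = emeasure (distr M' N (\<lambda>\<omega>. F (X' \<omega>))) A"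
      using emeasure_unit_ball_PiM[OF I] by (simp only: ennreal_mult_cancel_left infinity_ennreal_def) blast
  qed simp
  then show ?thesis
    using measurable_compose[OF mX F] measurable_compose[OF mX' F]
    unfolding equal_in_law_def by simp
qed

section \<open>The totalised inverse\<close>

lemma measurable_det:
  fixes A :: "'a \<Rightarrow> complex mat"
  assumes dim: "\<And>x. A x \<in> carrier_mat n n"
    and meas: "\<And>i j. i < n \<Longrightarrow> j < n \<Longrightarrow> (\<lambda>x. A x $$ (i, j)) \<in> borel_measurable M"
  shows "(\<lambda>x. det (A x)) \<in> borel_measurable M"
proof -
  have "(\<lambda>x. signof p * (\<Prod>i = 0..<n. A x $$ (i, p i))) \<in> borel_measurable M"
    if "p permutes {0..<n}" for p
    using that meas by (intro borel_measurable_times borel_measurable_prod) (auto dest: permutes_in_image)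
  then show ?thesis
    unfolding det_def'[OF dim] by (intro borel_measurable_sum) auto
qed

text \<open>A matrix returned by \<open>mat_inverse\<close> would force the product of two
  determinants to be 1, so the default value applies.\<close>

lemma inv_mat_singular:
  assumes A: "A \<in> carrier_mat n n" and d: "det A = 0"
  shows "inv_mat A = 0\<^sub>m n n"
proof (cases "mat_inverse A")
  case None
  with A show ?thesis by (simp add: inv_mat_def)
next
  case (Some B)
  note B = mat_inverse(2)[OF A Some]
  then have "det A * det B = 1" using det_mult[OF A, of B] by simp
  with d show ?thesis by simp
qed

lemma inv_mat_right_inverse:
  assumes A: "A \<in> carrier_mat n n" and B: "B \<in> carrier_mat n n" and AB: "A * B = 1\<^sub>m n"
  shows "inv_mat A = B"
proof -
  have "det A * det B = 1" using det_mult[OF A B] AB by simp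
  then have "det A \<noteq> 0" by auto
  \<comment> \<open>Both facts speak of the ring of matrices with a dummy extra component, set to
    \<open>()\<close> so that the rings coincide.\<close>
  then obtain C where C: "mat_inverse A = Some C"
    using mat_inverse(1)[OF A, where b = "()"] det_non_zero_imp_unit[OF A, where b = "()"] by blast
  note CA = mat_inverse(2)[OF A C]
  have "C = C * (A * B)" using AB CA right_mult_one_mat[of C n n] by simp
  also have "\<dots> = B" using A B CA by (simp add: assoc_mult_mat[symmetric, of _ n n _ n _ n])
  finally show ?thesis using C by (simp add: inv_mat_def)
qed

lemma mult_inverse_det_adj_mat:
  assumes A: "A \<in> carrier_mat n n" and d: "det A \<noteq> (0 :: complex)"
  shows "A * (inverse (det A) \<cdot>\<^sub>m adj_mat A) = 1\<^sub>m n"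
proof -
  have "A * (inverse (det A) \<cdot>\<^sub>m adj_mat A) = inverse (det A) \<cdot>\<^sub>m (A * adj_mat A)"
    by (rule mult_smult_distrib[OF A adj_mat(1)[OF A]])
  also have "\<dots> = 1\<^sub>m n" unfolding adj_mat(2)[OF A] using d by (intro eq_matI) auto
  finally show ?thesis .
qed

text \<open>Replaces the output of an elimination algorithm by a rational expression in the entries,
  from which measurability can be read off.\<close>

lemma inv_mat_adj_mat:
  assumes A: "A \<in> carrier_mat n n" and d: "det A \<noteq> 0"
  shows "inv_mat A = inverse (det A) \<cdot>\<^sub>m adj_mat A"
  using adj_mat(1)[OF A] mult_inverse_det_adj_mat[OF A d]
  by (intro inv_mat_right_inverse[OF A]) auto

lemma inv_mat_carrier [simp]: "A \<in> carrier_mat n n \<Longrightarrow> inv_mat A \<in> carrier_mat n n"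
  using adj_mat(1)[of A n] by (cases "det A = 0") (simp_all add: inv_mat_singular inv_mat_adj_mat)

lemma dim_inv_mat [simp]:
  assumes "dim_row A = dim_col A"
  shows "dim_row (inv_mat A) = dim_col A" "dim_col (inv_mat A) = dim_col A"
proof -
  have "inv_mat A \<in> carrier_mat (dim_col A) (dim_col A)"
    using assms by (intro inv_mat_carrier carrier_matI) simp_all
  then show "dim_row (inv_mat A) = dim_col A" "dim_col (inv_mat A) = dim_col A"
    by (rule carrier_matD)+
qed

text \<open>An entry is a cofactor divided by the determinant where the latter is nonzero, and 0
  elsewhere; determinants are polynomials in the entries.\<close>

lemma measurable_inv_mat:
  assumes dim: "\<And>x. A x \<in> carrier_mat n n"
    and meas: "\<And>i j. i < n \<Longrightarrow> j < n \<Longrightarrow> (\<lambda>x. A x $$ (i, j)) \<in> borel_measurable M"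
    and ij: "i < n" "j < n"
  shows "(\<lambda>x. inv_mat (A x) $$ (i, j)) \<in> borel_measurable M"
proof -
  have dimA: "dim_row (A x) = n" "dim_col (A x) = n" for x using dim[of x] by auto
  have [measurable]: "(\<lambda>x. det (A x)) \<in> borel_measurable M"
    by (rule measurable_det[OF dim meas])
  have "(\<lambda>x. det (mat_delete (A x) j i)) \<in> borel_measurable M"
  proof (rule measurable_det)
    show "mat_delete (A x) j i \<in> carrier_mat (n - 1) (n - 1)" for x
      by (rule mat_delete_carrier[OF dim])
    show "(\<lambda>x. mat_delete (A x) j i $$ (k, l)) \<in> borel_measurable M"
      if "k < n - 1" "l < n - 1" for k l
      using that meas by (simp add: mat_delete_def dimA)
  qed
  then have [measurable]: "(\<lambda>x. adj_mat (A x) $$ (i, j)) \<in> borel_measurable M"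
    using ij by (simp add: adj_mat_def dimA cofactor_def)
  have "inv_mat (A x) $$ (i, j)
      = (if det (A x) = 0 then 0 else inverse (det (A x)) * adj_mat (A x) $$ (i, j))" for x
    using ij adj_mat(1)[OF dim, of x]
    by (auto simp: inv_mat_singular[OF dim] inv_mat_adj_mat[OF dim])
  then show ?thesis by simp
qed

text \<open>The default value 0 is compatible with scaling, so the identity also holds for singular
  matrices and no exceptional null set has to be carried along.\<close>

lemma inv_mat_smult:
  assumes A: "A \<in> carrier_mat n n" and r: "r \<noteq> 0"
  shows "inv_mat (r \<cdot>\<^sub>m A) = inverse r \<cdot>\<^sub>m inv_mat A"
proof (cases "det A = 0")
  case True
  with A show ?thesis by (simp add: inv_mat_singular[of _ n])
next
  case False
  then have AB: "A * inv_mat A = 1\<^sub>m n"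
    using mult_inverse_det_adj_mat[OF A] by (simp add: inv_mat_adj_mat[OF A])
  have "(r \<cdot>\<^sub>m A) * (inverse r \<cdot>\<^sub>m inv_mat A) = inverse r \<cdot>\<^sub>m (r \<cdot>\<^sub>m (A * inv_mat A))"
    using A by (simp add: mult_smult_distrib[of _ n n _ n] mult_smult_assoc_mat[of _ n n _ n])
  also have "\<dots> = 1\<^sub>m n" unfolding AB using r by (intro eq_matI) auto
  finally show ?thesis using A by (intro inv_mat_right_inverse) auto
qed

lemma generalized_eigenvalues_smult:
  assumes "A \<in> carrier_mat n n" "B \<in> carrier_mat n n" and r: "r \<noteq> 0"
  shows "generalized_eigenvalues (r \<cdot>\<^sub>m A) (r \<cdot>\<^sub>m B) = generalized_eigenvalues A B"
proof -
  have "r \<cdot>\<^sub>m A - z \<cdot>\<^sub>m (r \<cdot>\<^sub>m B) = r \<cdot>\<^sub>m (A - z \<cdot>\<^sub>m B)" for z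
    using assms by (intro eq_matI) (auto simp: algebra_simps)
  with r show ?thesis by (simp add: generalized_eigenvalues_def)
qed

section \<open>Scaling and measurability of the Pade statistics\<close>

lemma hankel_carrier [simp]: "hankel m r s \<in> carrier_mat m m"
  by (simp add: hankel_def)

lemma dim_hankel [simp]: "dim_row (hankel m r s) = m" "dim_col (hankel m r s) = m"
  by (simp_all add: hankel_def)

lemma lower_toeplitz_carrier [simp]: "lower_toeplitz n a \<in> carrier_mat n n"
  by (simp add: lower_toeplitz_def)

lemma dim_lower_toeplitz [simp]: "dim_row (lower_toeplitz n a) = n" "dim_col (lower_toeplitz n a) = n"
  by (simp_all add: lower_toeplitz_def)

lemma vandermonde_carrier [simp]: "vandermonde m x \<in> carrier_mat m m"
  by (simp add: vandermonde_def)

lemma dim_vandermonde [simp]: "dim_row (vandermonde m x) = m" "dim_col (vandermonde m x) = m"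
  by (simp_all add: vandermonde_def)

lemma reciprocal_coeffs_eq:
  assumes "k < n"
  shows "reciprocal_coeffs n a k = inv_mat (lower_toeplitz n a) $$ (k, 0)"
  using assms by (simp add: reciprocal_coeffs_def)

lemma measurable_reciprocal_coeffs:
  assumes k: "k < n"
  shows "(\<lambda>a. reciprocal_coeffs n a k) \<in> borel_measurable (cvec_space n)"
  unfolding reciprocal_coeffs_eq[OF k]
proof (rule measurable_inv_mat[OF lower_toeplitz_carrier])
  fix i j assume "i < n" "j < n"
  then show "(\<lambda>a. lower_toeplitz n a $$ (i, j)) \<in> borel_measurable (cvec_space n)"
    by (auto simp: lower_toeplitz_def intro!: measurable_component_singleton)
qed (use k in auto)

text \<open>The largest index occurring in the matrix is \<open>2 * m + r - 2\<close>.\<close>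

lemma hankel_scale:
  assumes "\<And>k. k < 2 * m + r - 1 \<Longrightarrow> t k = c * s k"
  shows "hankel m r t = c \<cdot>\<^sub>m hankel m r s"
  using assms by (intro eq_matI) (auto simp: hankel_def)

section \<open>Effect of multiplying the data by a nonzero scalar\<close>

context
  fixes p :: nat and c :: complex and a b :: "nat \<Rightarrow> complex"
  assumes c: "c \<noteq> 0" and ab: "\<And>i. i < 2 * p \<Longrightarrow> b i = c * a i"
begin

lemma pade_poles_scale: "pade_poles p b = pade_poles p a"
proof -
  have "hankel p r b = c \<cdot>\<^sub>m hankel p r a" if "r \<le> 1" for r
    using that by (intro hankel_scale ab) auto
  then show ?thesis
    unfolding pade_poles_def using c by (simp add: generalized_eigenvalues_smult[of _ p])
qed

lemma reciprocal_coeffs_scale: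
  assumes "k < 2 * p"
  shows "reciprocal_coeffs (2 * p) b k = inverse c * reciprocal_coeffs (2 * p) a k"
proof -
  have "lower_toeplitz (2 * p) b = c \<cdot>\<^sub>m lower_toeplitz (2 * p) a"
    using ab by (intro eq_matI) (auto simp: lower_toeplitz_def)
  then show ?thesis
    using assms c by (simp add: reciprocal_coeffs_eq inv_mat_smult[of _ "2 * p"])
qed

lemma pade_zeros_scale: "pade_zeros p b = pade_zeros p a"
proof -
  have "hankel (p - 1) r (reciprocal_coeffs (2 * p) b)
      = inverse c \<cdot>\<^sub>m hankel (p - 1) r (reciprocal_coeffs (2 * p) a)" if "r \<le> 3" for r
  \<comment> \<open>For \<open>p \<le> 1\<close> the matrices are empty; this also avoids truncated
    subtraction at \<open>p = 0\<close>. Otherwise the largest offset 3 gives the index bound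
    \<open>2 * (p - 1) + 3 - 1 = 2 * p\<close>, exactly the number of coefficients
    available.\<close>
  proof (cases "p \<le> 1")
    case True
    then show ?thesis by (intro eq_matI) auto
  next
    case False
    with that show ?thesis by (intro hankel_scale reciprocal_coeffs_scale) simp
  qed
  then show ?thesis
    unfolding pade_zeros_def Let_def using c
    by (simp add: generalized_eigenvalues_smult[of _ "p - 1"])
qed

text \<open>The labelling sees only the unordered set of poles, so the chosen order is unaffected as
  well.\<close>

lemma pole_vector_scale: "pole_vector p \<Lambda> b = pole_vector p \<Lambda> a"
  by (simp add: pole_vector_def pade_poles_scale)

lemma zero_vector_scale: "zero_vector p \<Lambda> b = zero_vector p \<Lambda> a"
  by (simp add: zero_vector_def pade_zeros_scale)

text \<open>The Vandermonde matrix is built from the unchanged poles, so only the right-hand side of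
  the linear system is scaled.\<close>

lemma pole_residuals_scale: "pole_residuals p \<Lambda> b = c \<cdot>\<^sub>v pole_residuals p \<Lambda> a"
proof -
  have "vec p b = c \<cdot>\<^sub>v vec p a" using ab by (intro eq_vecI) auto
  then show ?thesis
    by (simp add: pole_residuals_def pole_vector_scale mult_mat_vec[of _ p p])
qed

lemma zero_residuals_scale: "zero_residuals p \<Lambda> b = inverse c \<cdot>\<^sub>v zero_residuals p \<Lambda> a"
proof -
  have "vec (p - 1) (\<lambda>k. reciprocal_coeffs (2 * p) b (k + 2))
      = inverse c \<cdot>\<^sub>v vec (p - 1) (\<lambda>k. reciprocal_coeffs (2 * p) a (k + 2))"
    by (intro eq_vecI) (auto intro!: reciprocal_coeffs_scale)
  then show ?thesis
    by (simp add: zero_residuals_def zero_vector_scale mult_mat_vec[of _ "p - 1" "p - 1"])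
qed

end

text \<open>The norm picks up the same positive factor. The zero vector is covered too, since
  division by zero yields 0 on both sides.\<close>

lemma normalized_smult:
  assumes "r > 0"
  shows "normalized (complex_of_real r \<cdot>\<^sub>v v) = normalized v"
proof -
  have "L2_set (\<lambda>i. cmod ((complex_of_real r \<cdot>\<^sub>v v) $ i)) {..<dim_vec v}
      = L2_set (\<lambda>i. r * cmod (v $ i)) {..<dim_vec v}"
    using assms by (intro L2_set_cong) (auto simp: norm_mult)
  also have "\<dots> = r * L2_set (\<lambda>i. cmod (v $ i)) {..<dim_vec v}"
    using assms by (simp add: L2_set_right_distrib)
  finally show ?thesis
    using assms unfolding normalized_def by (intro ext) (auto simp: restrict_def)
qed

section \<open>Measurability of the labelled poles, zeros and normalized residuals\<close>

lemma measurable_pole_vector: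
  assumes "pole_labelling p \<Lambda>"
  shows "pole_vector p \<Lambda> \<in> measurable (cvec_space (2 * p)) (cvec_space p)"
  using assms unfolding pole_vector_def[abs_def] pole_labelling_def
  by (intro measurable_restrict) auto

lemma measurable_zero_vector:
  assumes "zero_labelling p \<Lambda>"
  shows "zero_vector p \<Lambda> \<in> measurable (cvec_space (2 * p)) (cvec_space (p - 1))"
  using assms unfolding zero_vector_def[abs_def] zero_labelling_def
  by (intro measurable_restrict) auto

lemma measurable_normalized:
  assumes dim: "\<And>x. dim_vec (v x) = m"
    and [measurable]: "\<And>j. j < m \<Longrightarrow> (\<lambda>x. v x $ j) \<in> borel_measurable M"
  shows "(\<lambda>x. normalized (v x)) \<in> measurable M (cvec_space m)"
  unfolding normalized_def dim L2_set_def
  by (intro measurable_restrict) measurable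

lemma measurable_vandermonde_solution:
  assumes x: "x \<in> measurable M (cvec_space m)"
    and y: "\<And>k. k < m \<Longrightarrow> (\<lambda>\<omega>. y \<omega> k) \<in> borel_measurable M"
    and j: "j < m"
  shows "(\<lambda>\<omega>. (inv_mat (vandermonde m (x \<omega>)) *\<^sub>v vec m (y \<omega>)) $ j) \<in> borel_measurable M"
proof -
  have x': "(\<lambda>\<omega>. x \<omega> k) \<in> borel_measurable M" if "k < m" for k
    using measurable_compose[OF x measurable_component_singleton[of k]] that by simp
  have inv: "(\<lambda>\<omega>. inv_mat (vandermonde m (x \<omega>)) $$ (j, k)) \<in> borel_measurable M"
    if "k < m" for k
  proof (rule measurable_inv_mat[OF vandermonde_carrier])
    fix i l assume "i < m" "l < m"
    then show "(\<lambda>\<omega>. vandermonde m (x \<omega>) $$ (i, l)) \<in> borel_measurable M"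
      using x'[of l] by (simp add: vandermonde_def)
  qed (use that j in auto)
  have "(inv_mat (vandermonde m (x \<omega>)) *\<^sub>v vec m (y \<omega>)) $ j
      = (\<Sum>k\<in>{0..<m}. inv_mat (vandermonde m (x \<omega>)) $$ (j, k) * y \<omega> k)" for \<omega>
    using j by (auto simp: scalar_prod_def intro!: sum.cong)
  moreover have "(\<lambda>\<omega>. \<Sum>k\<in>{0..<m}. inv_mat (vandermonde m (x \<omega>)) $$ (j, k) * y \<omega> k)
      \<in> borel_measurable M"
    using inv y by (intro borel_measurable_sum borel_measurable_times) auto
  ultimately show ?thesis by simp
qed

lemma measurable_normalized_pole_residuals:
  assumes "pole_labelling p \<Lambda>"
  shows "(\<lambda>a. normalized (pole_residuals p \<Lambda> a)) \<in> measurable (cvec_space (2 * p)) (cvec_space p)"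
proof (rule measurable_normalized)
  show "dim_vec (pole_residuals p \<Lambda> a) = p" for a
    by (simp add: pole_residuals_def)
  show "(\<lambda>a. pole_residuals p \<Lambda> a $ j) \<in> borel_measurable (cvec_space (2 * p))" if "j < p" for j
    unfolding pole_residuals_def using that
    by (intro measurable_vandermonde_solution measurable_pole_vector assms
        measurable_component_singleton) auto
qed

lemma measurable_normalized_zero_residuals:
  assumes "zero_labelling p \<Lambda>"
  shows "(\<lambda>a. normalized (zero_residuals p \<Lambda> a))
    \<in> measurable (cvec_space (2 * p)) (cvec_space (p - 1))"
proof (rule measurable_normalized)
  show "dim_vec (zero_residuals p \<Lambda> a) = p - 1" for a
    by (simp add: zero_residuals_def)
  show "(\<lambda>a. zero_residuals p \<Lambda> a $ j) \<in> borel_measurable (cvec_space (2 * p))"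
    if "j < p - 1" for j
    unfolding zero_residuals_def using that
    by (intro measurable_vandermonde_solution measurable_zero_vector assms
        measurable_reciprocal_coeffs) auto
qed

section \<open>Transfer to complex data and conclusion\<close>

lemma standard_gaussian_density_radial:
  "standard_gaussian_density m x = (1 / sqrt (2 * pi)) ^ m * exp (- (L2_set x {..<m})\<^sup>2 / 2)"
  unfolding standard_gaussian_density_def std_normal_density_def prod.distrib L2_set_def
  by (simp add: exp_sum[symmetric] sum_negf sum_nonneg sum_divide_distrib)

text \<open>The statistic is rewritten as a function of the real vector of real and imaginary parts.
  Both densities depend on this vector only through its norm, so the uniqueness of laws for radial
  densities applies in dimension \<open>2 * n\<close>.\<close>

lemma equal_in_law_homogeneous_statistic:
  fixes T :: "(nat \<Rightarrow> complex) \<Rightarrow> 'c" and g :: "real \<Rightarrow> real"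
  assumes n: "n > 0"
    and M: "prob_space M" and M': "prob_space M'"
    and g: "\<And>r. g r \<ge> 0" "(\<lambda>r. ennreal (g r)) \<in> borel_measurable borel"
    and X: "distributed M (rvec_space (2 * n)) (\<lambda>\<omega>. re_im_vector n (a \<omega>))
           (\<lambda>x. ennreal (spherical_density n g x))"
    and X': "distributed M' (rvec_space (2 * n)) (\<lambda>\<omega>. re_im_vector n (a' \<omega>))
           (\<lambda>x. ennreal (standard_gaussian_density (2 * n) x))"
    and T: "T \<in> measurable (cvec_space n) N"
    and hom: "\<And>b c r. r > 0 \<Longrightarrow> (\<And>i. i < n \<Longrightarrow> c i = complex_of_real r * b i) \<Longrightarrow> T c = T b"
  shows "equal_in_law N M (\<lambda>\<omega>. T (a \<omega>)) M' (\<lambda>\<omega>. T (a' \<omega>))"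
proof -
  \<comment> \<open>\<open>C\<close> reassembles the complex data from their real and imaginary
    parts, inverting \<open>re_im_vector\<close> on the first \<open>n\<close> entries.\<close>
  define C :: "(nat \<Rightarrow> real) \<Rightarrow> nat \<Rightarrow> complex"
    where "C = (\<lambda>x. \<lambda>i\<in>{..<n}. Complex (x i) (x (n + i)))"
  define f where "f = (\<lambda>r. ennreal (Gamma (real n) / (2 * pi ^ n) * r powi (1 - 2 * int n) * g r))"
  define f' where "f' = (\<lambda>r. ennreal ((1 / sqrt (2 * pi)) ^ (2 * n) * exp (- r\<^sup>2 / 2)))"
  \<comment> \<open>Measurability is given for the \<open>ennreal\<close> version of
    \<open>g\<close>; nonnegativity allows \<open>g\<close> itself to be recovered.\<close>
  have "(\<lambda>r. enn2real (ennreal (g r))) \<in> borel_measurable borel"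
    using g(2) by measurable
  then have [measurable]: "g \<in> borel_measurable borel" using g(1) by simp
  have f: "f \<in> borel_measurable borel" unfolding f_def power_int_def by measurable
  have f': "f' \<in> borel_measurable borel" unfolding f'_def by measurable
  \<comment> \<open>Homogeneity with factor 1 says that \<open>T\<close> depends only on the first
    \<open>n\<close> entries, so the values of \<open>C\<close> beyond them are harmless.\<close>
  have TC: "T (C (re_im_vector n b)) = T b" for b
    by (rule hom[of 1]) (auto simp: C_def re_im_vector_def)
  have "C \<in> measurable (rvec_space (2 * n)) (cvec_space n)"
    unfolding C_def
  proof (intro measurable_restrict)
    fix i assume "i \<in> {..<n}"
    then have [measurable]: "(\<lambda>x. x i) \<in> borel_measurable (rvec_space (2 * n))"
      "(\<lambda>x. x (n + i)) \<in> borel_measurable (rvec_space (2 * n))"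
      using measurable_component_singleton[of _ "{..<2 * n}" "\<lambda>_. lborel :: real measure"]
      by auto
    show "(\<lambda>x. Complex (x i) (x (n + i))) \<in> borel_measurable (rvec_space (2 * n))"
      unfolding Complex_eq by measurable
  qed
  then have F: "(\<lambda>x. T (C x)) \<in> measurable (rvec_space (2 * n)) N"
    using T by (rule measurable_compose)
  have "equal_in_law N M (\<lambda>\<omega>. T (C (re_im_vector n (a \<omega>)))) M' (\<lambda>\<omega>. T (C (re_im_vector n (a' \<omega>))))"
  proof (rule radial_density_unique_law[OF _ _ M M' f f' _ _ F])
    show "distributed M (rvec_space (2 * n)) (\<lambda>\<omega>. re_im_vector n (a \<omega>))
        (\<lambda>x. f (L2_set x {..<2 * n}))"
      using X unfolding f_def spherical_density_def .
    show "distributed M' (rvec_space (2 * n)) (\<lambda>\<omega>. re_im_vector n (a' \<omega>))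
        (\<lambda>x. f' (L2_set x {..<2 * n}))"
      using X' unfolding f'_def standard_gaussian_density_radial .
    show "T (C (\<lambda>i\<in>{..<2 * n}. r * x i)) = T (C x)" if "r > 0" for x r
      using that by (rule hom) (auto simp: C_def complex_eq_iff)
  qed (use n in \<open>auto simp: lessThan_empty_iff\<close>)
  then show ?thesis by (simp add: TC)
qed

theorem theorem1:
  fixes p n :: nat
    and M :: "'a measure" and a :: "'a \<Rightarrow> nat \<Rightarrow> complex" and g :: "real \<Rightarrow> real"
    and M' :: "'b measure" and a' :: "'b \<Rightarrow> nat \<Rightarrow> complex"
    and \<Lambda>\<^sub>\<xi> \<Lambda>\<^sub>\<zeta> :: "complex set \<Rightarrow> nat \<Rightarrow> complex"
  assumes "p \<ge> 1" and "n = 2 * p"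
    and "prob_space M"
    and "\<And>r. g r \<ge> 0"
    and "distributed M lborel (\<lambda>\<omega>. L2_set (re_im_vector n (a \<omega>)) {..<2 * n}) (\<lambda>r. ennreal (g r))"
    and "distributed M (rvec_space (2 * n)) (\<lambda>\<omega>. re_im_vector n (a \<omega>))
           (\<lambda>x. ennreal (spherical_density n g x))"
    and "prob_space M'"
    and "distributed M' (rvec_space (2 * n)) (\<lambda>\<omega>. re_im_vector n (a' \<omega>))
           (\<lambda>x. ennreal (standard_gaussian_density (2 * n) x))"
    and "pole_labelling p \<Lambda>\<^sub>\<xi>" and "zero_labelling p \<Lambda>\<^sub>\<zeta>"
  shows "equal_in_law (cvec_space p)
           M (\<lambda>\<omega>. pole_vector p \<Lambda>\<^sub>\<xi> (a \<omega>)) M' (\<lambda>\<omega>. pole_vector p \<Lambda>\<^sub>\<xi> (a' \<omega>))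
     \<and> equal_in_law (cvec_space (p - 1))
           M (\<lambda>\<omega>. zero_vector p \<Lambda>\<^sub>\<zeta> (a \<omega>)) M' (\<lambda>\<omega>. zero_vector p \<Lambda>\<^sub>\<zeta> (a' \<omega>))
     \<and> equal_in_law (cvec_space p)
           M (\<lambda>\<omega>. normalized (pole_residuals p \<Lambda>\<^sub>\<xi> (a \<omega>)))
           M' (\<lambda>\<omega>. normalized (pole_residuals p \<Lambda>\<^sub>\<xi> (a' \<omega>)))
     \<and> equal_in_law (cvec_space (p - 1))
           M (\<lambda>\<omega>. normalized (zero_residuals p \<Lambda>\<^sub>\<zeta> (a \<omega>)))
           M' (\<lambda>\<omega>. normalized (zero_residuals p \<Lambda>\<^sub>\<zeta> (a' \<omega>)))"
proof -
  have n: "n > 0" using assms(1,2) by simp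
  have g: "(\<lambda>r. ennreal (g r)) \<in> borel_measurable borel"
    using assms(5) by (simp add: distributed_def)
  \<comment> \<open>Each of the four claims now reduces to measurability of its statistic and
    invariance under positive scaling of the data.\<close>
  note law = equal_in_law_homogeneous_statistic[OF n assms(3,7,4) g assms(6,8), unfolded assms(2)]
  show ?thesis
  proof (intro conjI law)
    fix b c :: "nat \<Rightarrow> complex" and r :: real
    assume r: "r > 0" and bc: "\<And>i. i < 2 * p \<Longrightarrow> c i = complex_of_real r * b i"
    then have r0: "complex_of_real r \<noteq> 0" by simp
    show "pole_vector p \<Lambda>\<^sub>\<xi> c = pole_vector p \<Lambda>\<^sub>\<xi> b"
      by (rule pole_vector_scale[OF r0 bc])
    show "zero_vector p \<Lambda>\<^sub>\<zeta> c = zero_vector p \<Lambda>\<^sub>\<zeta> b"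
      by (rule zero_vector_scale[OF r0 bc])
    show "normalized (pole_residuals p \<Lambda>\<^sub>\<xi> c) = normalized (pole_residuals p \<Lambda>\<^sub>\<xi> b)"
      using r by (simp add: pole_residuals_scale[OF r0 bc] normalized_smult)
    \<comment> \<open>The coefficients of the reciprocal series scale by \<open>inverse r\<close>,
      which is again positive.\<close>
    show "normalized (zero_residuals p \<Lambda>\<^sub>\<zeta> c) = normalized (zero_residuals p \<Lambda>\<^sub>\<zeta> b)"
      using normalized_smult[of "inverse r"] r by (simp add: zero_residuals_scale[OF r0 bc])
  qed (rule measurable_pole_vector measurable_zero_vector measurable_normalized_pole_residuals
      measurable_normalized_zero_residuals, rule assms(9,10))+
qed

end
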